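(* In Model II (described in the context), let $\pi_n^{(h)}$ be the stationary probability that there are $n$ high-priority customers in the system. Then, as $n\to\infty$, $$\pi_n^{(h)}\sim(1-\rho_1)\rho_1^n .$$ In particular, the decay rate in the marginal distribution for the high-priority queue is $\rho_1$.
   Context: Model II is the following preemptive priority queue with $N$-policy vacation ($N\ge1$ an integer). High-priority and low-priority customers arrive according to independent Poisson processes with rates $\lambda_1>0$ and $\lambda_2>0$; service times are exponential with rates $\mu_1>0$ and $\mu_2>0$ respectively, all independent. A single server serves each class FCFS, with high-priority customers having preemptive priority over low-priority ones. The server takes a vacation once the system becomes empty, and goes back to work as soon as either the number of low-priority customers reaches $N$ or a high-priority customer arrives; it then works until the system is empty again. Put $\rho_1=\lambda_1/\mu_1$, $\rho_2=\lambda_2/\mu_2$ and assume $\rho_1+\rho_2<1$ (so the stationary distribution exists). The notation $f(n)\sim g(n)$ means $\lim_{n\to\infty}f(n)/g(n)=1$. *)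

theory Defs
  imports "HOL-Analysis.Analysis" "HOL-Library.Landau_Symbols"
begin

section \<open>Stationary distributions of continuous-time Markov chains\<close>

text \<open>
  A chain on the state space \<open>S\<close> is given by its transition rates \<open>q s t\<close> for \<open>s \<noteq> t\<close>.
  The third condition is the equation \<open>\<pi> Q = 0\<close> for the generator \<open>Q\<close>, whose diagonal
  entries are \<open>- (\<Sum>t\<noteq>s. q s t)\<close>.
\<close>

definition stationary_distribution ::
    "'s set \<Rightarrow> ('s \<Rightarrow> 's \<Rightarrow> real) \<Rightarrow> ('s \<Rightarrow> real) \<Rightarrow> bool" where
  "stationary_distribution S q \<pi> \<longleftrightarrow>
     (\<forall>s\<in>S. 0 \<le> \<pi> s) \<and>
     (\<pi> has_sum 1) S \<and>
     (\<forall>s\<in>S. ((\<lambda>r. \<pi> r * q r s) has_sum (\<pi> s * (\<Sum>\<^sub>\<infinity>t\<in>S - {s}. q s t))) (S - {s}))"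

definition has_decay_rate :: "(nat \<Rightarrow> real) \<Rightarrow> real \<Rightarrow> bool" where
  "has_decay_rate p r \<longleftrightarrow> (\<lambda>n. root n (p n)) \<longlonglongrightarrow> r"


section \<open>The preemptive priority queue with N-policy vacation\<close>

text \<open>
  \<open>Vacation j\<close>: the server is on vacation and \<open>j\<close> low-priority customers (and no high-priority
  ones) are present.  \<open>Working i j\<close>: the server is working and \<open>i\<close> high-priority and \<open>j\<close>
  low-priority customers are present, including the one in service.  Since all interarrival and
  service times are exponential, neither the order within a class nor the elapsed service of a
  preempted customer has to be recorded.
\<close>

datatype queue_state = Vacation nat | Working nat nat

fun num_high :: "queue_state \<Rightarrow> nat" where
  "num_high (Vacation j) = 0"
| "num_high (Working i j) = i"

definition queue_states :: "nat \<Rightarrow> queue_state set" where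
  "queue_states N = {Vacation j |j. j < N} \<union> {Working i j |i j. 0 < i + j}"

fun arrive_high :: "queue_state \<Rightarrow> queue_state" where
  "arrive_high (Vacation j) = Working 1 j"
| "arrive_high (Working i j) = Working (i + 1) j"

fun arrive_low :: "nat \<Rightarrow> queue_state \<Rightarrow> queue_state" where
  "arrive_low N (Vacation j) = (if j + 1 < N then Vacation (j + 1) else Working 0 (j + 1))"
| "arrive_low N (Working i j) = Working i (j + 1)"

definition after_service :: "nat \<Rightarrow> nat \<Rightarrow> queue_state" where
  "after_service i j = (if i = 0 \<and> j = 0 then Vacation 0 else Working i j)"

text \<open>Low-priority customers are served only while no high-priority customer is present.\<close>

fun depart :: "queue_state \<Rightarrow> queue_state" where
  "depart (Vacation j) = Vacation j"
| "depart (Working i j) = (if 0 < i then after_service (i - 1) j else after_service 0 (j - 1))"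

fun service_rate :: "real \<Rightarrow> real \<Rightarrow> queue_state \<Rightarrow> real" where
  "service_rate \<mu>\<^sub>1 \<mu>\<^sub>2 (Vacation j) = 0"
| "service_rate \<mu>\<^sub>1 \<mu>\<^sub>2 (Working i j) = (if 0 < i then \<mu>\<^sub>1 else \<mu>\<^sub>2)"

definition queue_rate ::
    "nat \<Rightarrow> real \<Rightarrow> real \<Rightarrow> real \<Rightarrow> real \<Rightarrow> queue_state \<Rightarrow> queue_state \<Rightarrow> real" where
  "queue_rate N lam\<^sub>1 lam\<^sub>2 \<mu>\<^sub>1 \<mu>\<^sub>2 s t =
     lam\<^sub>1 * of_bool (t = arrive_high s) +
     lam\<^sub>2 * of_bool (t = arrive_low N s) +
     service_rate \<mu>\<^sub>1 \<mu>\<^sub>2 s * of_bool (t = depart s)"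

definition marginal_high :: "nat \<Rightarrow> (queue_state \<Rightarrow> real) \<Rightarrow> nat \<Rightarrow> real" where
  "marginal_high N \<pi> n = (\<Sum>\<^sub>\<infinity>s\<in>{s \<in> queue_states N. num_high s = n}. \<pi> s)"

end

theory Submission
  imports Defs
begin

text \<open>
  High-priority customers never notice the low-priority ones or the vacations: they interrupt
  low-priority services and end vacations at the moment they arrive.  Their number is therefore an
  M/M/1 queue by itself, and its stationary law is exactly geometric, so that the asymptotic
  equivalence holds as an equality.

  The law is obtained from the stationary equations by a cut argument.  In a stationary chain with
  bounded exit rates the probability flow out of any set of states equals the flow back into it
  (\<open>cut_balance\<close>).  Across the cut between at most \<open>n\<close> and at least \<open>n + 1\<close> high-priority customers
  the only upward transitions are high-priority arrivals, at the same rate \<open>\<lambda>\<^sub>1\<close> from every state at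
  level \<open>n\<close>, on vacation or not; the only downward transitions are high-priority services, at the
  same rate \<open>\<mu>\<^sub>1\<close> from every state at level \<open>n + 1\<close>.  Hence the marginal probabilities satisfy
  \<open>\<lambda>\<^sub>1 p\<^sub>n = \<mu>\<^sub>1 p\<^sub>n\<^sub>+\<^sub>1\<close> (\<open>marginal_high_Suc\<close>), and normalisation determines \<open>p\<^sub>0\<close>.
\<close>

text \<open>
  Summing the stationary equations over \<open>A\<close> equates the flow from \<open>A\<close> to everywhere with the flow
  from everywhere to \<open>A\<close>; the flow within \<open>A\<close> then cancels.  The bound on the exit rates makes the
  total flow finite, which justifies both the exchange of summations and the cancellation.
\<close>

lemma cut_balance:
  fixes q :: "'s \<Rightarrow> 's \<Rightarrow> real"
  assumes stat: "stationary_distribution S q \<pi>"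
    and nonneg: "\<And>s t. s \<in> S \<Longrightarrow> t \<in> S \<Longrightarrow> 0 \<le> q s t"
    and summable: "\<And>s. s \<in> S \<Longrightarrow> q s summable_on (S - {s})"
    and bounded: "\<And>s. s \<in> S \<Longrightarrow> (\<Sum>\<^sub>\<infinity>t\<in>S - {s}. q s t) \<le> C"
    and "A \<subseteq> S"
  shows "(\<Sum>\<^sub>\<infinity>s\<in>A. \<pi> s * (\<Sum>\<^sub>\<infinity>t\<in>S - A. q s t)) = (\<Sum>\<^sub>\<infinity>t\<in>S - A. \<pi> t * (\<Sum>\<^sub>\<infinity>s\<in>A. q t s))"
proof -
  have pi_nonneg: "0 \<le> \<pi> s" if "s \<in> S" for s
    using stat that by (auto simp: stationary_distribution_def)
  have pi_sum: "(\<pi> has_sum 1) S"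
    using stat by (auto simp: stationary_distribution_def)
  have balance: "((\<lambda>r. \<pi> r * q r s) has_sum (\<pi> s * (\<Sum>\<^sub>\<infinity>t\<in>S - {s}. q s t))) (S - {s})"
    if "s \<in> S" for s
    using stat that by (auto simp: stationary_distribution_def)
  define exit where "exit s = (\<Sum>\<^sub>\<infinity>t\<in>S - {s}. q s t)" for s
  define flow where "flow s t = (if s = t then 0 else \<pi> s * q s t)" for s t
  have out: "(flow s has_sum \<pi> s * exit s) S" if "s \<in> S" for s
  proof -
    have "(q s has_sum exit s) (S - {s})"
      unfolding exit_def using summable[OF that] by (rule has_sum_infsum)
    then have "((\<lambda>t. \<pi> s * q s t) has_sum \<pi> s * exit s) (S - {s})"
      by (rule has_sum_cmult_right)
    also have "?this \<longleftrightarrow> (flow s has_sum \<pi> s * exit s) S"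
      by (intro has_sum_cong_neutral) (auto simp: flow_def)
    finally show ?thesis .
  qed
  have into: "((\<lambda>r. flow r s) has_sum \<pi> s * exit s) S" if "s \<in> S" for s
  proof -
    have "((\<lambda>r. \<pi> r * q r s) has_sum \<pi> s * exit s) (S - {s})"
      unfolding exit_def using that by (rule balance)
    also have "?this \<longleftrightarrow> ((\<lambda>r. flow r s) has_sum \<pi> s * exit s) S"
      by (intro has_sum_cong_neutral) (auto simp: flow_def)
    finally show ?thesis .
  qed
  have exit_nonneg: "0 \<le> exit s" if "s \<in> S" for s
    unfolding exit_def using nonneg that by (intro infsum_nonneg) auto
  have total: "(\<lambda>s. \<pi> s * exit s) summable_on S"
  proof (rule summable_on_comparison_test)
    show "(\<lambda>s. \<pi> s * C) summable_on S"
      using pi_sum by (intro summable_on_cmult_left) (auto simp: summable_on_def)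
    show "\<pi> s * exit s \<le> \<pi> s * C" if "s \<in> S" for s
      using bounded[OF that] pi_nonneg[OF that] by (auto simp: exit_def intro: mult_left_mono)
    show "0 \<le> \<pi> s * exit s" if "s \<in> S" for s
      using exit_nonneg[OF that] pi_nonneg[OF that] by simp
  qed
  have flow_nonneg: "0 \<le> flow s t" if "s \<in> S" "t \<in> S" for s t
    using that nonneg pi_nonneg by (auto simp: flow_def)
  have flow_summable: "(\<lambda>(s, t). flow s t) summable_on S \<times> S"
    using total out flow_nonneg
    by (intro summable_on_SigmaI[where g = "\<lambda>s. \<pi> s * exit s"]) auto
  have sub: "(\<lambda>(s, t). flow s t) summable_on B" if "B \<subseteq> S \<times> S" for B
    using flow_summable that by (rule summable_on_subset_banach)
  let ?F = "\<lambda>B. \<Sum>\<^sub>\<infinity>(s, t)\<in>B. flow s t"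
  have split: "?F (B \<union> B') = ?F B + ?F B'"
    if "B \<subseteq> S \<times> S" "B' \<subseteq> S \<times> S" "B \<inter> B' = {}" for B B'
    using that by (intro infsum_Un_disjoint sub) auto
  have iter: "?F (B \<times> B') = (\<Sum>\<^sub>\<infinity>s\<in>B. \<Sum>\<^sub>\<infinity>t\<in>B'. flow s t)" if "B \<subseteq> S" "B' \<subseteq> S" for B B'
    using that by (intro infsum_Sigma'_banach[symmetric] sub) auto
  have swap: "?F (B \<times> B') = (\<Sum>\<^sub>\<infinity>t\<in>B'. \<Sum>\<^sub>\<infinity>s\<in>B. flow s t)" if "B \<subseteq> S" "B' \<subseteq> S" for B B'
  proof -
    have "(\<lambda>(s, t). flow s t) summable_on B \<times> B'"
      using that by (intro sub) auto
    from infsum_swap_banach[OF this] show ?thesis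
      using iter[OF that] by simp
  qed
  have "?F (A \<times> S) = (\<Sum>\<^sub>\<infinity>s\<in>A. \<pi> s * exit s)"
    unfolding iter[OF \<open>A \<subseteq> S\<close> subset_refl]
    by (rule infsum_cong, rule infsumI, rule out) (use \<open>A \<subseteq> S\<close> in auto)
  also have "\<dots> = ?F (S \<times> A)"
    unfolding swap[OF subset_refl \<open>A \<subseteq> S\<close>]
    by (rule infsum_cong, rule infsumI[symmetric], rule into) (use \<open>A \<subseteq> S\<close> in auto)
  also have "A \<times> S = A \<times> A \<union> A \<times> (S - A)"
    using \<open>A \<subseteq> S\<close> by auto
  also have "?F \<dots> = ?F (A \<times> A) + ?F (A \<times> (S - A))"
    using \<open>A \<subseteq> S\<close> by (intro split) auto
  also have "S \<times> A = A \<times> A \<union> (S - A) \<times> A"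
    using \<open>A \<subseteq> S\<close> by auto
  also have "?F \<dots> = ?F (A \<times> A) + ?F ((S - A) \<times> A)"
    using \<open>A \<subseteq> S\<close> by (intro split) auto
  finally have cross: "?F (A \<times> (S - A)) = ?F ((S - A) \<times> A)"
    by simp
  have cut: "?F (B \<times> B') = (\<Sum>\<^sub>\<infinity>s\<in>B. \<pi> s * (\<Sum>\<^sub>\<infinity>t\<in>B'. q s t))"
    if "B \<subseteq> S" "B' \<subseteq> S" "B \<inter> B' = {}" for B B'
  proof -
    have "(\<Sum>\<^sub>\<infinity>t\<in>B'. flow s t) = \<pi> s * (\<Sum>\<^sub>\<infinity>t\<in>B'. q s t)" if "s \<in> B" for s
    proof -
      have "(\<Sum>\<^sub>\<infinity>t\<in>B'. flow s t) = (\<Sum>\<^sub>\<infinity>t\<in>B'. \<pi> s * q s t)"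
        using \<open>s \<in> B\<close> \<open>B \<inter> B' = {}\<close> by (intro infsum_cong) (auto simp: flow_def)
      then show ?thesis
        by (simp add: infsum_cmult_right')
    qed
    then show ?thesis
      using that by (simp add: iter cong: infsum_cong)
  qed
  show ?thesis
    using cross cut[of A "S - A"] cut[of "S - A" A] \<open>A \<subseteq> S\<close> by auto
qed

lemma num_high_arrive_high [simp]: "num_high (arrive_high s) = Suc (num_high s)"
  by (cases s) auto

lemma num_high_arrive_low [simp]: "num_high (arrive_low N s) = num_high s"
  by (cases s) auto

lemma num_high_depart [simp]: "num_high (depart s) = num_high s - 1"
  by (cases s) (auto simp: after_service_def)

lemma arrive_high_in_queue_states [simp]: "arrive_high s \<in> queue_states N"
  by (cases s) (auto simp: queue_states_def)

lemma depart_in_queue_states: "1 \<le> N \<Longrightarrow> 0 < num_high s \<Longrightarrow> depart s \<in> queue_states N"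
  by (cases s) (auto simp: queue_states_def after_service_def)

lemma service_rate_eq_if_num_high: "0 < num_high s \<Longrightarrow> service_rate \<mu>\<^sub>1 \<mu>\<^sub>2 s = \<mu>\<^sub>1"
  by (cases s) auto

text \<open>
  The target set \<open>T\<close> is arbitrary, so that one formula yields both the exit rates and the rates
  through a cut.
\<close>

lemma has_sum_queue_rate:
  "(queue_rate N lam\<^sub>1 lam\<^sub>2 \<mu>\<^sub>1 \<mu>\<^sub>2 s has_sum
     (lam\<^sub>1 * of_bool (arrive_high s \<in> T) + lam\<^sub>2 * of_bool (arrive_low N s \<in> T)
       + service_rate \<mu>\<^sub>1 \<mu>\<^sub>2 s * of_bool (depart s \<in> T))) T"
proof -
  have single: "((\<lambda>t. c * of_bool (t = a)) has_sum c * of_bool (a \<in> T)) T"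
    for c :: real and a :: queue_state
    by (rule has_sum_finite_neutralI[where B = "T \<inter> {a}"]) auto
  show ?thesis
    unfolding queue_rate_def by (intro has_sum_add single)
qed

text \<open>
  Arrivals and services change the number of high-priority customers by at most one, so the flow
  through the cut above level \<open>n\<close> leaves from level \<open>n\<close> and returns from level \<open>n + 1\<close> only.  All
  states of one level contribute at the same rate, hence each flow is that rate times a marginal
  probability.
\<close>

lemma marginal_high_Suc:
  assumes "1 \<le> N" and "0 \<le> lam\<^sub>1" and "0 \<le> lam\<^sub>2" and "0 \<le> \<mu>\<^sub>1" and "0 \<le> \<mu>\<^sub>2"
    and "stationary_distribution (queue_states N) (queue_rate N lam\<^sub>1 lam\<^sub>2 \<mu>\<^sub>1 \<mu>\<^sub>2) \<pi>"
  shows "lam\<^sub>1 * marginal_high N \<pi> n = \<mu>\<^sub>1 * marginal_high N \<pi> (Suc n)"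
proof -
  let ?S = "queue_states N" and ?q = "queue_rate N lam\<^sub>1 lam\<^sub>2 \<mu>\<^sub>1 \<mu>\<^sub>2"
  define A where "A = {s \<in> ?S. num_high s \<le> n}"
  have service_rate_nonneg: "0 \<le> service_rate \<mu>\<^sub>1 \<mu>\<^sub>2 s" for s
    using assms by (cases s) auto
  have service_rate_le: "service_rate \<mu>\<^sub>1 \<mu>\<^sub>2 s \<le> \<mu>\<^sub>1 + \<mu>\<^sub>2" for s
    using assms by (cases s) auto
  have "(\<Sum>\<^sub>\<infinity>s\<in>A. \<pi> s * (\<Sum>\<^sub>\<infinity>t\<in>?S - A. ?q s t)) = (\<Sum>\<^sub>\<infinity>t\<in>?S - A. \<pi> t * (\<Sum>\<^sub>\<infinity>s\<in>A. ?q t s))"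
  proof (rule cut_balance[where C = "lam\<^sub>1 + lam\<^sub>2 + (\<mu>\<^sub>1 + \<mu>\<^sub>2)"])
    show "0 \<le> ?q s t" for s t
      using assms service_rate_nonneg by (auto simp: queue_rate_def)
    show "?q s summable_on (?S - {s})" for s
      using has_sum_queue_rate by (rule has_sum_imp_summable)
    show "(\<Sum>\<^sub>\<infinity>t\<in>?S - {s}. ?q s t) \<le> lam\<^sub>1 + lam\<^sub>2 + (\<mu>\<^sub>1 + \<mu>\<^sub>2)" for s
      using assms service_rate_nonneg service_rate_le
      by (subst infsumI[OF has_sum_queue_rate]) (intro add_mono, auto simp: of_bool_def)
  qed (use assms in \<open>auto simp: A_def\<close>)
  moreover have "(\<Sum>\<^sub>\<infinity>s\<in>A. \<pi> s * (\<Sum>\<^sub>\<infinity>t\<in>?S - A. ?q s t)) = lam\<^sub>1 * marginal_high N \<pi> n"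
  proof -
    have "(\<Sum>\<^sub>\<infinity>t\<in>?S - A. ?q s t) = lam\<^sub>1 * of_bool (num_high s = n)" if "s \<in> A" for s
      using that by (subst infsumI[OF has_sum_queue_rate]) (auto simp: A_def)
    then have "(\<Sum>\<^sub>\<infinity>s\<in>A. \<pi> s * (\<Sum>\<^sub>\<infinity>t\<in>?S - A. ?q s t))
        = (\<Sum>\<^sub>\<infinity>s\<in>{s \<in> ?S. num_high s = n}. lam\<^sub>1 * \<pi> s)"
      by (intro infsum_cong_neutral) (auto simp: A_def)
    then show ?thesis
      by (simp add: marginal_high_def infsum_cmult_right')
  qed
  moreover have "(\<Sum>\<^sub>\<infinity>t\<in>?S - A. \<pi> t * (\<Sum>\<^sub>\<infinity>s\<in>A. ?q t s)) = \<mu>\<^sub>1 * marginal_high N \<pi> (Suc n)"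
  proof -
    have "(\<Sum>\<^sub>\<infinity>s\<in>A. ?q t s) = \<mu>\<^sub>1 * of_bool (num_high t = Suc n)" if "t \<in> ?S - A" for t
      \<comment> \<open>\<open>1 \<le> N\<close> enters because a departure that empties the system leads to \<open>Vacation 0\<close>.\<close>
      using that \<open>1 \<le> N\<close>
      by (subst infsumI[OF has_sum_queue_rate])
        (auto simp: A_def depart_in_queue_states service_rate_eq_if_num_high)
    then have "(\<Sum>\<^sub>\<infinity>t\<in>?S - A. \<pi> t * (\<Sum>\<^sub>\<infinity>s\<in>A. ?q t s))
        = (\<Sum>\<^sub>\<infinity>t\<in>{t \<in> ?S. num_high t = Suc n}. \<mu>\<^sub>1 * \<pi> t)"
      by (intro infsum_cong_neutral) (auto simp: A_def)
    then show ?thesis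
      by (simp add: marginal_high_def infsum_cmult_right')
  qed
  ultimately show ?thesis
    by simp
qed

lemma marginal_high_sums:
  assumes "(\<pi> has_sum c) (queue_states N)"
  shows "marginal_high N \<pi> sums c"
proof -
  let ?level = "\<lambda>n. {s \<in> queue_states N. num_high s = n}"
  note assms
  also have "(\<pi> has_sum c) (queue_states N) \<longleftrightarrow> ((\<lambda>(n, s). \<pi> s) has_sum c) (Sigma UNIV ?level)"
    by (rule has_sum_reindex_bij_witness[where i = snd and j = "\<lambda>s. (num_high s, s)"]) auto
  finally have joint: "((\<lambda>(n, s). \<pi> s) has_sum c) (Sigma UNIV ?level)" .
  have "(\<pi> has_sum marginal_high N \<pi> n) (?level n)" for n
    unfolding marginal_high_def
    by (intro has_sum_infsum summable_on_subset_banach[OF has_sum_imp_summable[OF assms]]) auto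
  then have "(marginal_high N \<pi> has_sum c) UNIV"
    by (intro has_sum_SigmaD[OF joint]) simp
  then show ?thesis
    by (rule has_sum_imp_sums)
qed

text \<open>
  The recursion for the marginal probabilities makes them a geometric sequence, and the ratio
  being below 1 lets the normalisation fix the first term.
\<close>

lemma marginal_high_eq_geometric:
  assumes "1 \<le> N" and "0 \<le> lam\<^sub>1" and "0 \<le> lam\<^sub>2" and "lam\<^sub>1 < \<mu>\<^sub>1" and "0 \<le> \<mu>\<^sub>2"
    and stat: "stationary_distribution (queue_states N) (queue_rate N lam\<^sub>1 lam\<^sub>2 \<mu>\<^sub>1 \<mu>\<^sub>2) \<pi>"
  shows "marginal_high N \<pi> n = (1 - lam\<^sub>1 / \<mu>\<^sub>1) * (lam\<^sub>1 / \<mu>\<^sub>1) ^ n"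
proof -
  let ?p = "marginal_high N \<pi>" and ?r = "lam\<^sub>1 / \<mu>\<^sub>1"
  have r: "\<bar>?r\<bar> < 1"
    using assms by simp
  have "?p (Suc n) = ?r * ?p n" for n
    using marginal_high_Suc[of N lam\<^sub>1 lam\<^sub>2 \<mu>\<^sub>1 \<mu>\<^sub>2 \<pi> n] assms by (simp add: field_simps)
  then have geometric: "?p n = ?p 0 * ?r ^ n" for n
    by (induction n) auto
  have "(\<lambda>n. ?p 0 * ?r ^ n) sums (?p 0 * (1 / (1 - ?r)))"
    using r by (intro sums_mult geometric_sums) simp
  moreover have "?p sums 1"
    using stat by (intro marginal_high_sums) (simp add: stationary_distribution_def)
  ultimately have "?p 0 * (1 / (1 - ?r)) = 1"
    unfolding geometric[symmetric] by (rule sums_unique2)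
  then have "?p 0 = 1 - ?r"
    using r by (simp add: field_simps)
  then show ?thesis
    using geometric by metis
qed

lemma has_decay_rate_geometric:
  assumes "0 < c" and "0 \<le> r"
  shows "has_decay_rate (\<lambda>n. c * r ^ n) r"
  unfolding has_decay_rate_def
proof (rule Lim_transform_eventually)
  show "(\<lambda>n. root n c * r) \<longlonglongrightarrow> r"
    using tendsto_mult[OF LIMSEQ_root_const[OF \<open>0 < c\<close>] tendsto_const[of r]] by simp
  show "\<forall>\<^sub>F n in sequentially. root n c * r = root n (c * r ^ n)"
    using eventually_gt_at_top[of 0]
    by eventually_elim (simp add: real_root_mult real_root_power_cancel \<open>0 \<le> r\<close>)
qed

theorem theorem2:
  fixes N :: nat and lam\<^sub>1 lam\<^sub>2 \<mu>\<^sub>1 \<mu>\<^sub>2 \<rho>\<^sub>1 \<rho>\<^sub>2 :: real and \<pi> :: "queue_state \<Rightarrow> real"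
  assumes "1 \<le> N"
    and "0 < lam\<^sub>1" and "0 < lam\<^sub>2" and "0 < \<mu>\<^sub>1" and "0 < \<mu>\<^sub>2"
    and "\<rho>\<^sub>1 = lam\<^sub>1 / \<mu>\<^sub>1" and "\<rho>\<^sub>2 = lam\<^sub>2 / \<mu>\<^sub>2"
    and "\<rho>\<^sub>1 + \<rho>\<^sub>2 < 1"
    and "stationary_distribution (queue_states N) (queue_rate N lam\<^sub>1 lam\<^sub>2 \<mu>\<^sub>1 \<mu>\<^sub>2) \<pi>"
  shows "marginal_high N \<pi> \<sim>[sequentially] (\<lambda>n. (1 - \<rho>\<^sub>1) * \<rho>\<^sub>1 ^ n)
    \<and> has_decay_rate (marginal_high N \<pi>) \<rho>\<^sub>1"
proof -
  have "\<rho>\<^sub>1 < 1"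
    using assms by (smt (verit) divide_pos_pos)
  then have "lam\<^sub>1 < \<mu>\<^sub>1"
    using assms by (simp add: field_simps)
  have "marginal_high N \<pi> = (\<lambda>n. (1 - \<rho>\<^sub>1) * \<rho>\<^sub>1 ^ n)"
  proof
    show "marginal_high N \<pi> n = (1 - \<rho>\<^sub>1) * \<rho>\<^sub>1 ^ n" for n
      using assms \<open>lam\<^sub>1 < \<mu>\<^sub>1\<close> marginal_high_eq_geometric[of N lam\<^sub>1 lam\<^sub>2 \<mu>\<^sub>1 \<mu>\<^sub>2 \<pi> n] by simp
  qed
  then show ?thesis
    using \<open>\<rho>\<^sub>1 < 1\<close> assms by (simp add: has_decay_rate_geometric)
qed

end
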